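(* For $x\in(-1,1)$ and $m,k\in\mathbb{N}_0$, $0\le m\le k$, there are the mutually inverse sums $$P_k^{2m-k}(x)=m!\,k!\sum_{n=0}^{m}\frac{(-2)^n(1-x^2)^{\frac n2}}{(m-n)!\,(k-n)!\,n!}\,x^{k-n}P_{k-n}^{2m-k-n}\!\left(\frac1x\right),$$ $$x^kP_k^{2m-k}\!\left(\frac1x\right)=m!\,k!\sum_{n=0}^{m}\frac{2^n(1-x^2)^{\frac n2}}{(m-n)!\,(k-n)!\,n!}\,P_{k-n}^{2m-k-n}(x).$$
   Context: $\mathbb{N}_0=\{0,1,2,\dots\}$. $P_k^{\pm m}$ ($k,m\in\mathbb{N}_0$) are the associated Legendre polynomials, given for $k\ge m$ by $$P_k^{m}(x)=(-1)^m\frac{(k+m)!}{(k-m)!}P_k^{-m}(x)=\frac{(-1)^m(2m)!}{2^m m!}\,|1-x^2|^{\frac m2}\,C_{k-m}^{m+1/2}(x),$$ and $P_k^m(x)=0$ for $k<m$. Here $C_k^{\tau}(x)=\frac{1}{\Gamma(\tau)}\sum_{j=0}^{[k/2]}\frac{(-1)^j\Gamma(k-j+\tau)}{j!\,(k-2j)!}(2x)^{k-2j}$ is the Gegenbauer polynomial and $[\cdot]$ is the integer part.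
   Formalization: For |x|>1, P_k^M is the given formula times (-sgn x)^M if M≥0, or (sgn x)^|M| if M<0 (no Condon–Shortley phase); with the given sign the sums fail, e.g. k=m=1, 0<x<1. At x=0, where 1/x is undefined, both sums are two-sided limits. *)

theory Defs
  imports "HOL-Analysis.Analysis"
begin

definition gegenbauer :: "nat \<Rightarrow> real \<Rightarrow> real \<Rightarrow> real" where
  "gegenbauer k \<tau> x =
     (1 / Gamma \<tau>) *
     (\<Sum>j = 0..k div 2.
        (- 1) ^ j * Gamma (real k - real j + \<tau>) / (fact j * fact (k - 2 * j))
          * (2 * x) ^ (k - 2 * j))"

(* The power |1 - x^2|^(m/2) is a power of the square root, since 0 powr 0 = 0. *)
definition assoc_legendre_nonneg :: "nat \<Rightarrow> nat \<Rightarrow> real \<Rightarrow> real" where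
  "assoc_legendre_nonneg k m x =
     (if k < m then 0
      else (- 1) ^ m * fact (2 * m) / (2 ^ m * fact m) * sqrt \<bar>1 - x\<^sup>2\<bar> ^ m
             * gegenbauer (k - m) (real m + 1 / 2) x)"

(* Order M of either sign. The negative orders solve
   P_k^m = (-1)^m (k+m)!/(k-m)! P_k^(-m) for P_k^(-m); for k < m this gives 0. *)
definition assoc_legendre_formula :: "nat \<Rightarrow> int \<Rightarrow> real \<Rightarrow> real" where
  "assoc_legendre_formula k M x =
     (if 0 \<le> M then assoc_legendre_nonneg k (nat M) x
      else (- 1) ^ nat (- M) * fact (k - nat (- M)) / fact (k + nat (- M))
             * assoc_legendre_nonneg k (nat (- M)) x)"

(* On [-1, 1] this is the Ferrers function given by the formula above, including the
   Condon-Shortley phase. Off the cut it is the usual associated Legendre function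
   with (x^2 - 1)^(1/2) read as (x - 1)^(1/2) (x + 1)^(1/2) = sgn x * sqrt (x^2 - 1)
   and no phase, so that it differs from the formula by a sign at most. Without this
   sign the sums relating P(x) and P(1/x) fail: for k = m = 1 and 0 < x < 1 the first
   one would read - sqrt (1 - x^2) = - 3 * sqrt (1 - x^2). *)
definition assoc_legendre :: "nat \<Rightarrow> int \<Rightarrow> real \<Rightarrow> real" where
  "assoc_legendre k M x =
     (if \<bar>x\<bar> \<le> 1 then 1
      else if 0 \<le> M then (- sgn x) ^ nat M
      else sgn x ^ nat (- M))
     * assoc_legendre_formula k M x"

end

theory Submission
  imports Defs
begin

text \<open>
  Write \<open>k = m + j\<close>, so that the order \<open>2 m - k\<close> is \<open>m - j\<close>. In the sums \<open>k\<close> and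
  \<open>m\<close> drop by \<open>n\<close> together, so \<open>j\<close> stays fixed while \<open>m\<close> runs down to \<open>0\<close>. The degree
  minus the order is always \<open>2 j\<close>, an even number; hence for \<open>m \<ge> j\<close> the Gegenbauer
  polynomial in \<open>P\<close> is an even polynomial of degree \<open>2 j\<close>, and collecting its
  coefficients gives
  \<open>P\<^sub>k\<^sup>m\<^sup>-\<^sup>j(x) = (- 2 s)\<^sup>m\<^sup>-\<^sup>j / j! \<cdot> H\<^sub>m(x\<^sup>2, 1)\<close> with \<open>s = sqrt (1 - x\<^sup>2)\<close> and
  \<open>H\<^sub>m(u, v) = \<Sum>b\<le>j. (j choose b) (- 1)\<^sup>j\<^sup>-\<^sup>b (b + 1/2)\<^sub>m u\<^sup>b v\<^sup>j\<^sup>-\<^sup>b\<close>, where \<open>(a)\<^sub>m\<close> is the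
  rising factorial. The form \<open>H\<close> is the result of applying \<open>(D + 1/2)\<^sub>m\<close>, with \<open>D\<close>
  the Euler operator in \<open>u\<close>, to \<open>(u - v)\<^sup>j\<close>.

  Off the cut the same computation holds with \<open>- 2 s\<close> replaced by
  \<open>2 sgn z sqrt (z\<^sup>2 - 1)\<close>. As \<open>H\<close> is homogeneous of degree \<open>j\<close>, the substitution
  \<open>z = 1/x\<close> followed by multiplication with \<open>x\<^sup>k\<close> just exchanges the arguments:
  \<open>x\<^sup>k P\<^sub>k\<^sup>m\<^sup>-\<^sup>j(1/x) = (2 s)\<^sup>m\<^sup>-\<^sup>j / j! \<cdot> H\<^sub>m(1, x\<^sup>2)\<close>.

  Both sums therefore say how \<open>H\<^sub>m(v, u)\<close> is a combination of \<open>H\<^sub>p(u, v)\<close>, \<open>p \<le> m\<close>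
  (\<open>legendre_form_inversion\<close>). Coefficient by coefficient this is the
  Chu-Vandermonde identity, with parameters \<open>b + 1/2\<close> and \<open>j + 1\<close>.
  The two sums are the same statement with \<open>u\<close> and \<open>v\<close> exchanged and the sign of
  \<open>s\<close> reversed. They are mutually inverse because, for fixed \<open>j\<close>, they multiply the
  generating functions with coefficients \<open>P / (m! k!)\<close> at \<open>t\<^sup>m\<close> by \<open>exp (- 2 s t)\<close> and
  \<open>exp (2 s t)\<close>.

  The orders \<open>m - j < 0\<close> are defined through the positive order \<open>j - m\<close>, which
  leads to \<open>H\<close> with \<open>m\<close> and \<open>j\<close> exchanged. A second use of Chu-Vandermonde expands \<open>H\<close>
  in powers of \<open>u - v\<close>, and in this shape it is symmetric in \<open>m\<close> and \<open>j\<close> up to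
  elementary factors (\<open>legendre_form_swap\<close>); so one formula covers both signs
  (\<open>assoc_legendre_eq\<close>). At \<open>x = 0\<close>, where \<open>1/x\<close> is meaningless, the sums hold in the
  limit because \<open>P\<close> is continuous inside the cut.
\<close>

section \<open>The binary forms behind the Legendre functions\<close>

text \<open>
  Two variables instead of one make the passage from \<open>x\<close> to \<open>1 / x\<close> an exchange
  of \<open>u\<close> and \<open>v\<close>, without any division.
\<close>

definition legendre_form :: "nat \<Rightarrow> nat \<Rightarrow> real \<Rightarrow> real \<Rightarrow> real" where
  "legendre_form m j u v =
     (\<Sum>b\<le>j. of_nat (j choose b) * (- 1) ^ (j - b) * pochhammer (of_nat b + 1 / 2) m * u ^ b * v ^ (j - b))"

lemma pochhammer_uminus_of_nat:
  "pochhammer (- of_nat n :: real) a = (- 1) ^ a * fact a * of_nat (n choose a)"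
  by (simp add: binomial_gbinomial gbinomial_pochhammer power_mult_distrib[symmetric]
      flip: mult.assoc)

text \<open>
  Up to sign, \<open>pochhammer (- b) a\<close> is the falling factorial by which \<open>u\<^sup>a d\<^sup>a/du\<^sup>a\<close>
  acts on \<open>u\<^sup>b\<close>; so both sides are this operator applied to \<open>(u - v)\<^sup>j\<close>.
\<close>

lemma binomial_sum_pochhammer:
  fixes u v :: real
  shows "(\<Sum>b\<le>j. of_nat (j choose b) * (- 1) ^ (j - b) * pochhammer (- of_nat b) a * u ^ b * v ^ (j - b))
     = pochhammer (- of_nat j) a * u ^ a * (u - v) ^ (j - a)"
proof (cases "a \<le> j")
  case False
  then have "pochhammer (- of_nat b :: real) a = 0" if "b \<le> j" for b
    using that by (simp add: pochhammer_of_nat_eq_0_iff)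
  then show ?thesis by simp
next
  case True
  have absorb: "of_nat (j choose (c + a)) * pochhammer (- of_nat (c + a) :: real) a
      = pochhammer (- of_nat j) a * of_nat ((j - a) choose c)" if "c \<le> j - a" for c
  proof -
    have "(j choose (c + a)) * ((c + a) choose a) = (j choose a) * ((j - a) choose c)"
      using choose_mult[of a "c + a" j] that True by simp
    then have "real (j choose (c + a)) * real ((c + a) choose a)
        = real (j choose a) * real ((j - a) choose c)"
      by (metis of_nat_mult)
    then show ?thesis unfolding pochhammer_uminus_of_nat by simp
  qed
  have "(\<Sum>b\<le>j. of_nat (j choose b) * (- 1) ^ (j - b) * pochhammer (- of_nat b) a * u ^ b * v ^ (j - b))
      = (\<Sum>b=0+a..(j - a)+a. of_nat (j choose b) * (- 1) ^ (j - b) * pochhammer (- of_nat b) a * u ^ b * v ^ (j - b))"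
    using True by (intro sum.mono_neutral_right) (auto simp: pochhammer_of_nat_eq_0_iff)
  also have "\<dots> = (\<Sum>c=0..j-a. of_nat (j choose (c + a)) * (- 1) ^ (j - (c + a))
      * pochhammer (- of_nat (c + a)) a * u ^ (c + a) * v ^ (j - (c + a)))"
    by (rule sum.shift_bounds_cl_nat_ivl)
  also have "\<dots> = (\<Sum>c\<le>j-a. pochhammer (- of_nat j) a * u ^ a
      * (of_nat ((j - a) choose c) * u ^ c * (- v) ^ (j - a - c)))"
    unfolding atMost_atLeast0
  proof (rule sum.cong[OF refl])
    fix c assume "c \<in> {0..j - a}"
    then have c: "c \<le> j - a" and e: "j - (c + a) = j - a - c" by auto
    show "of_nat (j choose (c + a)) * (- 1) ^ (j - (c + a))
      * pochhammer (- of_nat (c + a)) a * u ^ (c + a) * v ^ (j - (c + a))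
      = pochhammer (- of_nat j) a * u ^ a
      * (of_nat ((j - a) choose c) * u ^ c * (- v) ^ (j - a - c))"
      unfolding e power_minus[of v] power_add
      using arg_cong[OF absorb[OF c], of "\<lambda>t. t * (u ^ c * u ^ a * ((- 1) ^ (j - a - c) * v ^ (j - a - c)))"]
      by (simp only: mult_ac)
  qed
  also have "\<dots> = pochhammer (- of_nat j) a * u ^ a * (u - v) ^ (j - a)"
    using binomial_ring[of u "- v" "j - a"] by (simp add: sum_distrib_left)
  finally show ?thesis .
qed

lemma pochhammer_half_neq_0: "pochhammer (1 / 2 :: real) a \<noteq> 0"
  using pochhammer_pos[of "1/2 :: real" a] by simp

text \<open>
  Chu-Vandermonde, read as the expansion of a shifted rising factorial in falling
  factorials of \<open>b\<close>, to which \<open>binomial_sum_pochhammer\<close> applies.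
\<close>

lemma pochhammer_shift_half:
  "pochhammer (of_nat b + 1 / 2 :: real) m =
     pochhammer (1 / 2) m * (\<Sum>a\<le>m. pochhammer (- of_nat m) a * pochhammer (- of_nat b) a
                                        / (fact a * pochhammer (1 / 2) a))"
proof -
  have "\<forall>i\<in>{0..<m}. (1 / 2 :: real) \<noteq> - of_nat i"
    by (smt (verit) of_nat_0_le_iff divide_pos_pos)
  from Vandermonde_pochhammer[OF this, of "- of_nat b"] show ?thesis
    using pochhammer_half_neq_0[of m] by (simp add: field_simps atMost_atLeast0)
qed

text \<open>
  The summation range is larger than the support \<open>a \<le> min m j\<close> so that it is
  symmetric in \<open>m\<close> and \<open>j\<close>; for \<open>a > j\<close> the exponent \<open>j - a\<close> is cut off at \<open>0\<close>, but
  the coefficient vanishes.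
\<close>

lemma legendre_form_expand:
  "legendre_form m j u v = pochhammer (1 / 2) m *
     (\<Sum>a\<le>m + j. pochhammer (- of_nat m) a * pochhammer (- of_nat j) a
                  / (fact a * pochhammer (1 / 2) a) * u ^ a * (u - v) ^ (j - a))"
proof -
  have "legendre_form m j u v = (\<Sum>b\<le>j. \<Sum>a\<le>m. pochhammer (1 / 2) m * pochhammer (- of_nat m) a / (fact a * pochhammer (1 / 2) a) *
     (of_nat (j choose b) * (- 1) ^ (j - b) * pochhammer (- of_nat b) a * u ^ b * v ^ (j - b)))"
    unfolding legendre_form_def pochhammer_shift_half
    by (simp add: sum_distrib_left sum_distrib_right mult_ac)
  also have "\<dots> = (\<Sum>a\<le>m. pochhammer (1 / 2) m * pochhammer (- of_nat m) a / (fact a * pochhammer (1 / 2) a) *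
     (pochhammer (- of_nat j) a * u ^ a * (u - v) ^ (j - a)))"
    by (subst sum.swap) (simp only: binomial_sum_pochhammer flip: sum_distrib_left)
  also have "\<dots> = (\<Sum>a\<le>m+j. pochhammer (1 / 2) m * pochhammer (- of_nat m) a / (fact a * pochhammer (1 / 2) a) *
     (pochhammer (- of_nat j) a * u ^ a * (u - v) ^ (j - a)))"
    by (intro sum.mono_neutral_left) (auto simp: pochhammer_of_nat_eq_0_iff)
  finally show ?thesis by (simp add: sum_distrib_left mult_ac)
qed

text \<open>
  After multiplication with \<open>(u - v)\<^sup>m\<close> the terms of \<open>legendre_form_expand\<close> carry the power
  \<open>m + j - a\<close> of \<open>u - v\<close>, so that only the factor \<open>pochhammer (1 / 2) m\<close> distinguishes \<open>m\<close>
  from \<open>j\<close>. This relates the functions of orders \<open>m - j\<close> and \<open>j - m\<close>.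
\<close>

lemma legendre_form_swap:
  "pochhammer (1 / 2) j * (u - v) ^ m * legendre_form m j u v
     = pochhammer (1 / 2) m * (u - v) ^ j * legendre_form j m u v"
proof -
  have "pochhammer (- of_nat m :: real) a * pochhammer (- of_nat j) a
          * ((u - v) ^ m * (u - v) ^ (j - a))
      = pochhammer (- of_nat j) a * pochhammer (- of_nat m) a
          * ((u - v) ^ j * (u - v) ^ (m - a))" for a
  proof (cases "a \<le> m \<and> a \<le> j")
    case True
    then show ?thesis by (simp add: add.commute flip: power_add)
  next
    case False
    then show ?thesis by (auto simp: pochhammer_of_nat_eq_0_iff not_le)
  qed
  then have term_eq: "(u - v) ^ m * (pochhammer (- of_nat m) a * pochhammer (- of_nat j) a
          / (fact a * pochhammer (1 / 2) a) * u ^ a * (u - v) ^ (j - a))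
      = (u - v) ^ j * (pochhammer (- of_nat j) a * pochhammer (- of_nat m) a
          / (fact a * pochhammer (1 / 2) a) * u ^ a * (u - v) ^ (m - a))" for a
    by (simp add: field_simps pochhammer_half_neq_0)
  have "(u - v) ^ m * (\<Sum>a\<le>m + j. pochhammer (- of_nat m) a * pochhammer (- of_nat j) a
          / (fact a * pochhammer (1 / 2) a) * u ^ a * (u - v) ^ (j - a))
      = (u - v) ^ j * (\<Sum>a\<le>m + j. pochhammer (- of_nat j) a * pochhammer (- of_nat m) a
          / (fact a * pochhammer (1 / 2) a) * u ^ a * (u - v) ^ (m - a))"
    unfolding sum_distrib_left by (rule sum.cong[OF refl term_eq])
  then show ?thesis
    unfolding legendre_form_expand[of m j] legendre_form_expand[of j m] add.commute[of j m]
    by simp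
qed

lemma legendre_form_flip:
  "legendre_form m j v u
     = (\<Sum>b\<le>j. of_nat (j choose b) * (- 1) ^ b * pochhammer (of_nat (j - b) + 1 / 2) m * u ^ b * v ^ (j - b))"
  unfolding legendre_form_def
  by (rule sum.reindex_bij_witness[of _ "\<lambda>b. j - b" "\<lambda>b. j - b"])
     (auto simp: binomial_symmetric[symmetric] mult_ac)

text \<open>
  Chu-Vandermonde with denominator parameter \<open>j + 1\<close>, rewritten in factorials.
  It supplies every coefficient of \<open>legendre_form_inversion\<close>.
\<close>

lemma alternating_pochhammer_sum:
  "(\<Sum>p\<le>m. (- 1) ^ p * pochhammer a p / (fact (m - p) * fact p * fact (p + j)))
     = pochhammer (of_nat j + 1 - a) m / (fact m * fact (m + j) :: real)"
proof -
  have nz: "pochhammer (1 + of_nat j) p > (0 :: real)" for p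
    by (rule pochhammer_pos) simp
  have F: "fact (p + j) = (fact j * pochhammer (1 + of_nat j) p :: real)" for p
    unfolding pochhammer_fact by (subst add.commute) (rule pochhammer_product')
  have B: "pochhammer (- of_nat m :: real) p = (- 1) ^ p * fact m / fact (m - p)" if "p \<le> m" for p
    using that by (simp add: pochhammer_uminus_of_nat binomial_fact)
  have "\<forall>i\<in>{0..<m}. (1 + of_nat j :: real) \<noteq> - of_nat i"
    by (smt (verit) of_nat_0_le_iff)
  from Vandermonde_pochhammer[OF this, of a]
  have "pochhammer (1 + of_nat j - a) m / (fact m * fact (m + j)) =
     (\<Sum>p\<le>m. pochhammer a p * pochhammer (- of_nat m) p / (fact p * pochhammer (1 + of_nat j) p)) / (fact m * fact j)"
    using nz[of m] by (simp add: F[of m] atMost_atLeast0 divide_simps mult_ac)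
  also have "\<dots> = (\<Sum>p\<le>m. (- 1) ^ p * pochhammer a p / (fact (m - p) * fact p * fact (p + j)))"
    unfolding sum_divide_distrib by (intro sum.cong refl) (auto simp: F B mult_ac)
  finally show ?thesis by (simp add: add.commute)
qed

text \<open>
  The coefficient of \<open>u\<^sup>b v\<^sup>j\<^sup>-\<^sup>b\<close> on the right contains
  \<open>alternating_pochhammer_sum\<close> at \<open>a = b + 1/2\<close>, whose value has the parameter
  \<open>j + 1 - a = (j - b) + 1/2\<close>: the reflection \<open>b \<mapsto> j - b\<close> that exchanges \<open>u\<close> and \<open>v\<close>.
\<close>

lemma legendre_form_inversion:
  "legendre_form m j v u / (fact m * fact (m + j))
     = (- 1) ^ j * (\<Sum>p\<le>m. (- 1) ^ p * legendre_form p j u v / (fact (m - p) * fact p * fact (p + j)))"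
proof -
  have "(- 1) ^ j * (\<Sum>p\<le>m. (- 1) ^ p * legendre_form p j u v / (fact (m - p) * fact p * fact (p + j)))
      = (\<Sum>p\<le>m. \<Sum>b\<le>j. (- 1) ^ j * of_nat (j choose b) * (- 1) ^ (j - b) * u ^ b * v ^ (j - b)
          * ((- 1) ^ p * pochhammer (of_nat b + 1 / 2) p / (fact (m - p) * fact p * fact (p + j))))"
    unfolding legendre_form_def
    by (simp add: sum_distrib_left sum_divide_distrib mult_ac)
  also have "\<dots> = (\<Sum>b\<le>j. (- 1) ^ j * of_nat (j choose b) * (- 1) ^ (j - b) * u ^ b * v ^ (j - b)
          * (pochhammer (of_nat j + 1 - (of_nat b + 1 / 2)) m / (fact m * fact (m + j))))"
    by (subst sum.swap) (simp only: alternating_pochhammer_sum flip: sum_distrib_left)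
  also have "\<dots> = legendre_form m j v u / (fact m * fact (m + j))"
    unfolding legendre_form_flip sum_divide_distrib
  proof (rule sum.cong[OF refl])
    fix b assume "b \<in> {..j}"
    then have b: "b \<le> j" by simp
    have s: "(- 1 :: real) ^ j * (- 1) ^ (j - b) = (- 1) ^ b"
      using b by (simp add: minus_one_power_iff)
    have a: "real j + 1 - (real b + 1 / 2) = real (j - b) + 1 / 2"
      using b by (simp add: of_nat_diff field_simps)
    show "(- 1) ^ j * of_nat (j choose b) * (- 1) ^ (j - b) * u ^ b * v ^ (j - b)
          * (pochhammer (of_nat j + 1 - (of_nat b + 1 / 2)) m / (fact m * fact (m + j)))
       = of_nat (j choose b) * (- 1) ^ b * pochhammer (of_nat (j - b) + 1 / 2) m * u ^ b * v ^ (j - b)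
          / (fact m * fact (m + j))"
      unfolding a s[symmetric] by (simp add: mult_ac)
  qed
  finally show ?thesis by simp
qed

lemma legendre_form_scale: "c ^ j * legendre_form m j u v = legendre_form m j (c * u) (c * v)"
  unfolding legendre_form_def sum_distrib_left
proof (intro sum.cong refl)
  fix b assume "b \<in> {..j}"
  then have "c ^ j = c ^ b * c ^ (j - b)" by (simp flip: power_add)
  then show "c ^ j * (of_nat (j choose b) * (- 1) ^ (j - b) * pochhammer (of_nat b + 1 / 2) m * u ^ b * v ^ (j - b))
     = of_nat (j choose b) * (- 1) ^ (j - b) * pochhammer (of_nat b + 1 / 2) m * (c * u) ^ b * (c * v) ^ (j - b)"
    by (simp add: power_mult_distrib)
qed

text \<open>
  The inversion in the normalisation of the Legendre functions. With \<open>s\<close> equal to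
  \<open>- 2 sqrt (1 - x\<^sup>2)\<close> and \<open>2 sqrt (1 - x\<^sup>2)\<close> it becomes the two sums; the scaling
  turns the signs \<open>(- 1)\<^sup>p\<close> and \<open>(- 1)\<^sup>j\<close> into the change from \<open>s\<close> to \<open>- s\<close>.
\<close>

lemma legendre_form_sum:
  fixes s :: real
  shows "s ^ m / s ^ j * legendre_form m j v u / fact j =
    fact m * fact (m + j) * (\<Sum>n=0..m. s ^ n / (fact (m - n) * fact (m + j - n) * fact n)
       * ((- s) ^ (m - n) / (- s) ^ j * legendre_form (m - n) j u v / fact j))"
proof -
  have "(\<Sum>n=0..m. s ^ n / (fact (m - n) * fact (m + j - n) * fact n)
       * ((- s) ^ (m - n) / (- s) ^ j * legendre_form (m - n) j u v / fact j))
    = (\<Sum>p\<le>m. s ^ m / s ^ j / fact j * ((- 1) ^ j * ((- 1) ^ p * legendre_form p j u v / (fact (m - p) * fact p * fact (p + j)))))"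
    unfolding atMost_atLeast0
  proof (rule sum.reindex_bij_witness[of _ "\<lambda>p. m - p" "\<lambda>p. m - p"])
    fix n assume "n \<in> {0..m}"
    then obtain p where p: "m = n + p" by (auto simp: le_iff_add)
    show "s ^ m / s ^ j / fact j * ((- 1) ^ j * ((- 1) ^ (m - n) * legendre_form (m - n) j u v / (fact (m - (m - n)) * fact (m - n) * fact (m - n + j))))
     = s ^ n / (fact (m - n) * fact (m + j - n) * fact n)
       * ((- s) ^ (m - n) / (- s) ^ j * legendre_form (m - n) j u v / fact j)"
      by (simp add: p power_add power_minus[of s] add.assoc minus_one_power_iff mult_ac)
  qed auto
  also have "\<dots> = s ^ m / s ^ j / fact j * (legendre_form m j v u / (fact m * fact (m + j)))"
    unfolding legendre_form_inversion by (simp only: sum_distrib_left)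
  finally show ?thesis by simp
qed

section \<open>Associated Legendre functions as binary forms\<close>

text \<open>
  Reversing the summation index, all Gamma values become rising factorials of
  \<open>1/2\<close>, and \<open>(2 b)! = 4\<^sup>b (1/2)\<^sub>b b!\<close> cancels the powers of \<open>2\<close>. The factor
  \<open>pochhammer (1 / 2) M\<close> comes from \<open>(2 M)! / (2\<^sup>M M!) = 2\<^sup>M (1/2)\<^sub>M\<close> in the
  definition of \<open>P\<close>.
\<close>

lemma gegenbauer_even:
  "pochhammer (1 / 2) M * gegenbauer (2 * j) (of_nat M + 1 / 2) z
     = legendre_form (M + j) j (z\<^sup>2) 1 / fact j"
proof -
  have nz: "Gamma (1 / 2 :: real) \<noteq> 0" by (simp add: Gamma_one_half_real)
  have "(1 / 2 :: real) \<notin> \<int>\<^sub>\<le>\<^sub>0" by (auto elim: nonpos_Ints_cases)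
  then have G: "Gamma (of_nat n + 1 / 2) = pochhammer (1 / 2) n * Gamma (1 / 2 :: real)" for n
    using nz by (simp add: pochhammer_Gamma add.commute)
  have "(\<Sum>i = 0..j. (- 1) ^ i * Gamma (real (2 * j) - real i + (real M + 1 / 2)) / (fact i * fact (2 * j - 2 * i))
          * (2 * z) ^ (2 * j - 2 * i))
     = (\<Sum>b\<le>j. Gamma (1 / 2) * (real (j choose b) * (- 1) ^ (j - b) * pochhammer (of_nat b + 1 / 2) (M + j)
            * (z\<^sup>2) ^ b / fact j))"
    unfolding atMost_atLeast0
  proof (rule sum.reindex_bij_witness[of _ "\<lambda>b. j - b" "\<lambda>b. j - b"])
    fix i assume "i \<in> {0..j}"
    then obtain b where b: "j = i + b" by (auto simp: le_iff_add)
    have g: "real (2 * j) - real i + (real M + 1 / 2) = real (b + (M + j)) + 1 / 2"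
      unfolding b by simp
    have pp: "pochhammer (1 / 2 :: real) (b + (M + j))
        = pochhammer (1 / 2) b * pochhammer (of_nat b + 1 / 2) (M + j)"
      using pochhammer_product'[of "1 / 2 :: real" b "M + j"] by (simp add: add.commute)
    have e: "2 * j - 2 * i = 2 * b" "j - i = b" unfolding b by simp_all
    show "Gamma (1 / 2) * (real (j choose (j - i)) * (- 1) ^ (j - (j - i)) * pochhammer (of_nat (j - i) + 1 / 2) (M + j)
            * (z\<^sup>2) ^ (j - i) / fact j)
       = (- 1) ^ i * Gamma (real (2 * j) - real i + (real M + 1 / 2)) / (fact i * fact (2 * j - 2 * i))
          * (2 * z) ^ (2 * j - 2 * i)"
      unfolding g G pp e fact_double power_mult power_mult_distrib using pochhammer_half_neq_0[of b]
      by (simp add: b binomial_fact mult_ac)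
  qed auto
  then have "gegenbauer (2 * j) (of_nat M + 1 / 2) z
      = 1 / Gamma (of_nat M + 1 / 2) * (Gamma (1 / 2) * (legendre_form (M + j) j (z\<^sup>2) 1 / fact j))"
    unfolding gegenbauer_def legendre_form_def by (simp flip: sum_distrib_left sum_divide_distrib)
  then show ?thesis
    unfolding G using nz pochhammer_half_neq_0[of M] by simp
qed

text \<open>
  The quantity whose power \<open>m - j\<close> multiplies the form in \<open>P\<close>; the sign unites
  the conventions on and off the cut.
\<close>

definition legendre_base :: "real \<Rightarrow> real" where
  "legendre_base z = (if \<bar>z\<bar> \<le> 1 then - 1 else sgn z) * 2 * sqrt \<bar>1 - z\<^sup>2\<bar>"

lemma assoc_legendre_nonneg_eq:
  "assoc_legendre_nonneg (M + 2 * j) M z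
     = (- 2 * sqrt \<bar>1 - z\<^sup>2\<bar>) ^ M / fact j * legendre_form (M + j) j (z\<^sup>2) 1"
proof -
  have "assoc_legendre_nonneg (M + 2 * j) M z
      = (- 1) ^ M * 2 ^ M * sqrt \<bar>1 - z\<^sup>2\<bar> ^ M * (pochhammer (1 / 2) M * gegenbauer (2 * j) (of_nat M + 1 / 2) z)"
    unfolding assoc_legendre_nonneg_def using power_mult_distrib[of 2 "2 :: real" M]
    by (simp add: fact_double power_mult)
  also have "\<dots> = (- 2 * sqrt \<bar>1 - z\<^sup>2\<bar>) ^ M / fact j * legendre_form (M + j) j (z\<^sup>2) 1"
    unfolding gegenbauer_even by (simp add: power_mult_distrib power_minus[of "2 * _"])
  finally show ?thesis .
qed

text \<open>
  The power \<open>m - j\<close> of the base is a quotient since it may be negative. For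
  \<open>j > m\<close> the definition produces the positive power \<open>j - m\<close> and the form with \<open>m\<close> and
  \<open>j\<close> exchanged. Undoing the exchange by \<open>legendre_form_swap\<close> brings in a power
  of \<open>z\<^sup>2 - 1\<close>, which is the square of the base up to a constant factor and so makes
  the exponent negative. This needs \<open>z\<^sup>2 \<noteq> 1\<close>.
\<close>

lemma assoc_legendre_eq:
  assumes "\<bar>z\<bar> \<noteq> 1"
  shows "assoc_legendre (m + j) (int m - int j) z
     = legendre_base z ^ m / legendre_base z ^ j * legendre_form m j (z\<^sup>2) 1 / fact j"
proof -
  define q where "q = sqrt \<bar>1 - z\<^sup>2\<bar>"
  define w where "w = legendre_base z"
  define \<sigma> where "\<sigma> = (if \<bar>z\<bar> \<le> 1 then - 1 else sgn z)"
  have w: "w = \<sigma> * 2 * q" by (simp add: w_def legendre_base_def q_def \<sigma>_def)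
  have nz: "z\<^sup>2 - 1 \<noteq> 0" using assms by (simp add: power2_eq_1_iff abs_if split: if_splits)
  then have "q \<noteq> 0" by (simp add: q_def)
  then have wnz: "w \<noteq> 0" by (auto simp: w \<sigma>_def sgn_if)
  show ?thesis
  proof (cases "j \<le> m")
    case True
    then obtain M where M: "m = M + j" by (metis le_add_diff_inverse2)
    have "assoc_legendre (m + j) (int m - int j) z
        = (if \<bar>z\<bar> \<le> 1 then 1 else (- sgn z) ^ M) * assoc_legendre_nonneg (M + 2 * j) M z"
      by (simp add: M assoc_legendre_def assoc_legendre_formula_def mult_2 add.assoc)
    also have "\<dots> = w ^ M / fact j * legendre_form m j (z\<^sup>2) 1"
      unfolding assoc_legendre_nonneg_eq by (auto simp: w \<sigma>_def q_def M mult.assoc simp flip: power_mult_distrib)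
    finally show ?thesis using wnz by (simp add: M power_add w_def)
  next
    case False
    then obtain M where M: "j = M + m" and "M > 0" by (metis le_add_diff_inverse2 nat_le_linear zero_less_diff not_le)
    have sw: "pochhammer (1 / 2) m * (z\<^sup>2 - 1) ^ M * legendre_form j m (z\<^sup>2) 1 =
        pochhammer (1 / 2) j * legendre_form m j (z\<^sup>2) 1"
      using legendre_form_swap[of j "z\<^sup>2" 1 m] nz by (simp add: M power_add)
    \<comment> \<open>The definition at order \<open>- M\<close> yields the \<open>M\<close>-th power of \<open>2 q\<close>, with the sign of \<open>z\<close> off the cut.
      This turns it into a power of \<open>1 / w\<close>, times the power of \<open>z\<^sup>2 - 1\<close> that \<open>sw\<close> absorbs.\<close>
    have w2: "(if \<bar>z\<bar> \<le> 1 then 1 else sgn z) * 2 * q * w = 4 * (z\<^sup>2 - 1)"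
    proof (cases "\<bar>z\<bar> \<le> 1")
      case True
      then have "z\<^sup>2 \<le> 1" by (simp add: abs_square_le_1)
      then show ?thesis using True by (simp add: w \<sigma>_def q_def flip: power2_eq_square)
    next
      case False
      then have "z\<^sup>2 > 1" by (simp add: abs_square_le_1 not_le flip: not_le)
      then show ?thesis using False by (auto simp: w \<sigma>_def q_def sgn_if simp flip: power2_eq_square)
    qed
    have "assoc_legendre (m + j) (int m - int j) z
        = (if \<bar>z\<bar> \<le> 1 then 1 else sgn z) ^ M *
           ((- 1) ^ M * fact (2 * m) / fact (2 * j) * assoc_legendre_nonneg (M + 2 * m) M z)"
      using \<open>M > 0\<close>
      by (auto simp add: M assoc_legendre_def assoc_legendre_formula_def mult_2 add.assoc add.commute add.left_commute)
    also have "\<dots> = (if \<bar>z\<bar> \<le> 1 then 1 else sgn z) ^ M * (2 * q) ^ M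
         * (fact (2 * m) / (fact (2 * j) * fact m) * legendre_form j m (z\<^sup>2) 1)"
      unfolding assoc_legendre_nonneg_eq q_def[symmetric]
      by (simp add: M power_mult_distrib power_minus[of "2 * q"])
    also have "\<dots> = (4 * (z\<^sup>2 - 1)) ^ M / w ^ M
         * (fact (2 * m) / (fact (2 * j) * fact m) * legendre_form j m (z\<^sup>2) 1)"
      unfolding w2[symmetric] using wnz by (simp add: power_mult_distrib)
    also have "\<dots> = 1 / w ^ M * legendre_form m j (z\<^sup>2) 1 / fact j"
    proof -
      have "(4 * (z\<^sup>2 - 1)) ^ M * (fact (2 * m) / (fact (2 * j) * fact m) * legendre_form j m (z\<^sup>2) 1)
          = (pochhammer (1 / 2) m * (z\<^sup>2 - 1) ^ M * legendre_form j m (z\<^sup>2) 1)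
             / (pochhammer (1 / 2) j * fact j)"
        unfolding fact_double power_mult_distrib[of 4 "z\<^sup>2 - 1" M]
        by (simp add: M power_add power_mult power_mult_distrib)
      then show ?thesis
        unfolding sw using pochhammer_half_neq_0[of j] by (simp add: divide_simps)
    qed
    finally show ?thesis using wnz by (simp add: M power_add w_def)
  qed
qed

lemma assoc_legendre_on_cut:
  assumes "\<bar>x\<bar> < 1"
  shows "assoc_legendre (m + j) (int m - int j) x
     = (- 2 * sqrt (1 - x\<^sup>2)) ^ m / (- 2 * sqrt (1 - x\<^sup>2)) ^ j * legendre_form m j (x\<^sup>2) 1 / fact j"
proof -
  have "x\<^sup>2 < 1" using assms by (simp add: abs_square_less_1)
  then show ?thesis using assms by (subst assoc_legendre_eq) (auto simp: legendre_base_def)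
qed

text \<open>
  Of the power \<open>x\<^sup>m\<^sup>+\<^sup>j\<close>, the part \<open>x\<^sup>m\<^sup>-\<^sup>j\<close> clears the denominator of the base
  \<open>2 sqrt (1 - x\<^sup>2) / x\<close>, and \<open>x\<^sup>2\<^sup>j\<close> clears that of the form. The sign of \<open>x\<close> in
  the base is the one in the convention off the cut.
\<close>

lemma assoc_legendre_off_cut:
  assumes "\<bar>x\<bar> < 1" "x \<noteq> 0"
  shows "x ^ (m + j) * assoc_legendre (m + j) (int m - int j) (1 / x)
     = (2 * sqrt (1 - x\<^sup>2)) ^ m / (2 * sqrt (1 - x\<^sup>2)) ^ j * legendre_form m j 1 (x\<^sup>2) / fact j"
proof -
  have x2: "x\<^sup>2 < 1" using assms by (simp add: abs_square_less_1)
  have big: "\<bar>1 / x\<bar> > 1" using assms by (simp add: field_simps)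
  have "\<bar>1 - (1 / x)\<^sup>2\<bar> = (1 - x\<^sup>2) / x\<^sup>2"
    using x2 assms by (simp add: field_simps abs_if)
  then have "legendre_base (1 / x) = 2 * sqrt (1 - x\<^sup>2) / x"
    using big assms by (auto simp: legendre_base_def real_sqrt_divide sgn_if abs_if)
  then have "x ^ (m + j) * assoc_legendre (m + j) (int m - int j) (1 / x)
     = (2 * sqrt (1 - x\<^sup>2)) ^ m / (2 * sqrt (1 - x\<^sup>2)) ^ j * ((x\<^sup>2) ^ j * legendre_form m j ((1 / x)\<^sup>2) 1) / fact j"
    using big assms
    by (subst assoc_legendre_eq)
       (auto simp: power_add power_divide power_mult_distrib power2_eq_square mult_ac)
  also have "(x\<^sup>2) ^ j * legendre_form m j ((1 / x)\<^sup>2) 1 = legendre_form m j 1 (x\<^sup>2)"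
    using assms by (simp add: legendre_form_scale power_divide)
  finally show ?thesis .
qed

section \<open>The mutually inverse sums\<close>

lemma assoc_legendre_sums:
  fixes x :: real
  assumes "\<bar>x\<bar> < 1" "x \<noteq> 0" "m \<le> k"
  shows "assoc_legendre k (2 * int m - int k) x =
         fact m * fact k *
         (\<Sum>n = 0..m. (- 2) ^ n * sqrt (1 - x\<^sup>2) ^ n / (fact (m - n) * fact (k - n) * fact n)
            * x ^ (k - n) * assoc_legendre (k - n) (2 * int m - int k - int n) (1 / x))" (is ?A)
    and "x ^ k * assoc_legendre k (2 * int m - int k) (1 / x) =
         fact m * fact k *
         (\<Sum>n = 0..m. 2 ^ n * sqrt (1 - x\<^sup>2) ^ n / (fact (m - n) * fact (k - n) * fact n)
            * assoc_legendre (k - n) (2 * int m - int k - int n) x)" (is ?B)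
proof -
  obtain j where k: "k = m + j" using assms(3) by (auto simp: le_iff_add)
  have idx: "2 * int m - int k = int m - int j" by (simp add: k)
  have deg: "k - n = (m - n) + j" "int m - int j - int n = int (m - n) - int j"
    if "n \<le> m" for n
    using that by (auto simp: k)
  define q where "q = sqrt (1 - x\<^sup>2)"
  have mm: "- (- 2 * q) = 2 * q" by simp
  have "(\<Sum>n = 0..m. (- 2) ^ n * q ^ n / (fact (m - n) * fact (k - n) * fact n)
        * x ^ (k - n) * assoc_legendre (k - n) (int m - int j - int n) (1 / x))
      = (\<Sum>n = 0..m. (- 2 * q) ^ n / (fact (m - n) * fact (m + j - n) * fact n)
        * ((2 * q) ^ (m - n) / (2 * q) ^ j * legendre_form (m - n) j 1 (x\<^sup>2) / fact j))"
    (is "?off = _")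
  proof (rule sum.cong[OF refl])
    fix n assume "n \<in> {0..m}"
    then have n: "n \<le> m" by simp
    show "(- 2) ^ n * q ^ n / (fact (m - n) * fact (k - n) * fact n)
        * x ^ (k - n) * assoc_legendre (k - n) (int m - int j - int n) (1 / x)
      = (- 2 * q) ^ n / (fact (m - n) * fact (m + j - n) * fact n)
        * ((2 * q) ^ (m - n) / (2 * q) ^ j * legendre_form (m - n) j 1 (x\<^sup>2) / fact j)"
      unfolding k[symmetric] deg[OF n] power_mult_distrib[of "- 2" q n]
      unfolding q_def assoc_legendre_off_cut[OF assms(1,2), symmetric]
      by (simp only: mult.assoc)
  qed
  then have "fact m * fact k * ?off = assoc_legendre k (int m - int j) x"
    using legendre_form_sum[of "- 2 * q" m j "x\<^sup>2" 1, unfolded mm]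
    unfolding k assoc_legendre_on_cut[OF assms(1), folded q_def] by simp
  then show ?A unfolding idx q_def by (rule sym)
  have "(\<Sum>n = 0..m. 2 ^ n * q ^ n / (fact (m - n) * fact (k - n) * fact n)
        * assoc_legendre (k - n) (int m - int j - int n) x)
      = (\<Sum>n = 0..m. (2 * q) ^ n / (fact (m - n) * fact (m + j - n) * fact n)
        * ((- (2 * q)) ^ (m - n) / (- (2 * q)) ^ j * legendre_form (m - n) j (x\<^sup>2) 1 / fact j))"
    (is "?on = _")
  proof (rule sum.cong[OF refl])
    fix n assume "n \<in> {0..m}"
    then have n: "n \<le> m" by simp
    show "2 ^ n * q ^ n / (fact (m - n) * fact (k - n) * fact n)
        * assoc_legendre (k - n) (int m - int j - int n) x
      = (2 * q) ^ n / (fact (m - n) * fact (m + j - n) * fact n)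
        * ((- (2 * q)) ^ (m - n) / (- (2 * q)) ^ j * legendre_form (m - n) j (x\<^sup>2) 1 / fact j)"
      unfolding k[symmetric] deg[OF n] power_mult_distrib[of 2 q n]
      unfolding q_def mult_minus_left[symmetric]
        assoc_legendre_on_cut[OF assms(1), symmetric] ..
  qed
  then have "fact m * fact k * ?on = x ^ k * assoc_legendre k (int m - int j) (1 / x)"
    using legendre_form_sum[of "2 * q" m j 1 "x\<^sup>2"]
    unfolding k assoc_legendre_off_cut[OF assms(1,2), folded q_def] by simp
  then show ?B unfolding idx q_def by (rule sym)
qed

text \<open>
  Inside the cut \<open>1 - x\<^sup>2\<close> is positive, so negative powers of its root are harmless.
\<close>

lemma isCont_assoc_legendre:
  assumes "\<bar>x\<bar> < 1"
  shows "isCont (assoc_legendre (m + j) (int m - int j)) x"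
proof -
  have "x\<^sup>2 < 1" using assms by (simp add: abs_square_less_1)
  then have "isCont (\<lambda>x. (- 2 * sqrt (1 - x\<^sup>2)) ^ m / (- 2 * sqrt (1 - x\<^sup>2)) ^ j * legendre_form m j (x\<^sup>2) 1 / fact j) x"
    unfolding legendre_form_def by (intro continuous_intros) auto
  moreover have "\<forall>\<^sub>F y in nhds x. \<bar>y\<bar> < 1"
    using assms by (intro eventually_nhds_in_open[of "{-1<..<1}", THEN eventually_mono]) auto
  then have "\<forall>\<^sub>F y in nhds x. assoc_legendre (m + j) (int m - int j) y = (- 2 * sqrt (1 - y\<^sup>2)) ^ m / (- 2 * sqrt (1 - y\<^sup>2)) ^ j * legendre_form m j (y\<^sup>2) 1 / fact j"
    by eventually_elim (rule assoc_legendre_on_cut)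
  ultimately show ?thesis by (subst isCont_cong)
qed

theorem corollary7:
  fixes x :: real and m k :: nat
  assumes "x \<in> {-1<..<1}" and "m \<le> k"
  shows
    "(x \<noteq> 0 \<longrightarrow>
       assoc_legendre k (2 * int m - int k) x =
         fact m * fact k *
         (\<Sum>n = 0..m. (- 2) ^ n * sqrt (1 - x\<^sup>2) ^ n / (fact (m - n) * fact (k - n) * fact n)
            * x ^ (k - n) * assoc_legendre (k - n) (2 * int m - int k - int n) (1 / x)) \<and>
       x ^ k * assoc_legendre k (2 * int m - int k) (1 / x) =
         fact m * fact k *
         (\<Sum>n = 0..m. 2 ^ n * sqrt (1 - x\<^sup>2) ^ n / (fact (m - n) * fact (k - n) * fact n)
            * assoc_legendre (k - n) (2 * int m - int k - int n) x)) \<and>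
     (x = 0 \<longrightarrow>
       ((\<lambda>t. fact m * fact k *
         (\<Sum>n = 0..m. (- 2) ^ n * sqrt (1 - t\<^sup>2) ^ n / (fact (m - n) * fact (k - n) * fact n)
            * t ^ (k - n) * assoc_legendre (k - n) (2 * int m - int k - int n) (1 / t)))
        \<longlongrightarrow> assoc_legendre k (2 * int m - int k) 0) (at 0) \<and>
       ((\<lambda>t. t ^ k * assoc_legendre k (2 * int m - int k) (1 / t))
        \<longlongrightarrow> fact m * fact k *
         (\<Sum>n = 0..m. 2 ^ n * sqrt (1 - 0\<^sup>2) ^ n / (fact (m - n) * fact (k - n) * fact n)
            * assoc_legendre (k - n) (2 * int m - int k - int n) 0)) (at 0))"
proof -
  \<comment> \<open>At \<open>0\<close>, apply the sums at nearby points, where one side is a combination of values of \<open>P\<close> inside the cut.\<close>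
  have near: "\<forall>\<^sub>F t in at (0 :: real). \<bar>t\<bar> < 1 \<and> t \<noteq> 0"
    by (auto simp: eventually_at dist_real_def intro!: exI[of _ 1])
  have cont: "(assoc_legendre (k - n) (2 * int m - int k - int n)
      \<longlongrightarrow> assoc_legendre (k - n) (2 * int m - int k - int n) 0) (at 0)" if "n \<le> m" for n
  proof -
    have "k - n = (m - n) + (k - m)" "2 * int m - int k - int n = int (m - n) - int (k - m)"
      using that assms(2) by auto
    then show ?thesis using isCont_assoc_legendre[of 0 "m - n" "k - m"] by (simp add: isCont_def)
  qed
  have first: "((\<lambda>t. fact m * fact k *
         (\<Sum>n = 0..m. (- 2) ^ n * sqrt (1 - t\<^sup>2) ^ n / (fact (m - n) * fact (k - n) * fact n)
            * t ^ (k - n) * assoc_legendre (k - n) (2 * int m - int k - int n) (1 / t)))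
        \<longlongrightarrow> assoc_legendre k (2 * int m - int k) 0) (at 0)"
  proof (rule Lim_transform_eventually)
    show "(assoc_legendre k (2 * int m - int k) \<longlongrightarrow> assoc_legendre k (2 * int m - int k) 0) (at 0)"
      using cont[of 0] by simp
  qed (use near in eventually_elim, use assoc_legendre_sums(1)[OF _ _ assms(2)] in blast)
  have second: "((\<lambda>t. t ^ k * assoc_legendre k (2 * int m - int k) (1 / t))
        \<longlongrightarrow> fact m * fact k *
         (\<Sum>n = 0..m. 2 ^ n * sqrt (1 - 0\<^sup>2) ^ n / (fact (m - n) * fact (k - n) * fact n)
            * assoc_legendre (k - n) (2 * int m - int k - int n) 0)) (at 0)"
  proof (rule Lim_transform_eventually)
    show "((\<lambda>t. fact m * fact k *
         (\<Sum>n = 0..m. 2 ^ n * sqrt (1 - t\<^sup>2) ^ n / (fact (m - n) * fact (k - n) * fact n)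
            * assoc_legendre (k - n) (2 * int m - int k - int n) t))
        \<longlongrightarrow> fact m * fact k *
         (\<Sum>n = 0..m. 2 ^ n * sqrt (1 - 0\<^sup>2) ^ n / (fact (m - n) * fact (k - n) * fact n)
            * assoc_legendre (k - n) (2 * int m - int k - int n) 0)) (at 0)"
      by (intro tendsto_intros cont) auto
  qed (use near in eventually_elim, rule assoc_legendre_sums(2)[OF _ _ assms(2), symmetric], simp_all)
  show ?thesis
    by (intro conjI impI assoc_legendre_sums[OF _ _ assms(2)] first second) (use assms(1) in auto)
qed

end
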